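(* Let $n\ge3$ and let $A=\{s_i:1\le i\le n\}\subseteq S$ with all sites in $A$ being neighbors of each other under $\partial$. Then a sufficient condition for the permutation property of the joint distribution of $X_{s_1},\dots,X_{s_n}$ is that $\hat\pi_{s_i}(\cdot)\equiv\pi_{s_i}(\cdot)$ for $1\le i\le n$.
   Context: $(S,\partial)$ is a connected finite space of sites with a neighborhood system $\partial$ ($s\notin\partial(s)$; $s\in\partial(t)$ iff $t\in\partial(s)$; $t$ is a neighbor of $s$ if $t\in\partial(s)$). For each $s_i$, $\mathbf{X}_{s_i}$ is a finite set of reals; $\pi_{s_i}$ is a strictly positive pmf on $\mathbf{X}_{s_i}$, and $\tilde\pi_{s_i},\hat\pi_{s_i}$ are two auxiliary pmfs on $\mathbf{X}_{s_i}$; $\mu_{\tilde\pi_{s_i}}$ and $\sigma^2_{\tilde\pi_{s_i}}>0$ are the mean and variance of $\tilde\pi_{s_i}$. $\beta_{s_i,s_j}=\beta_{s_j,s_i}$ ($i\neq j$) are real numbers (prescribed covariances). For every ordering $t_1,\dots,t_n$ of the sites of $A$, the joint pmf $\Pi_{t_1,\dots,t_n}$ of the field generated sequentially in this order is defined by $\Pi_{t_1}=\pi_{t_1}$ and, for $2\le i\le n$, $$\Pi_{t_1,\dots,t_i}(x_{t_1},\dots,x_{t_i})=\Pi_{t_1,\dots,t_{i-1}}(x_{t_1},\dots,x_{t_{i-1}})\,\pi_{t_i}(x_{t_i})+\frac{\tilde\pi_{t_i}(x_{t_i})(x_{t_i}-\mu_{\tilde\pi_{t_i}})}{\sigma^2_{\tilde\pi_{t_i}}}\sum_{j=1}^{i-1}\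 \prod_{k=1,k\ne j}^{i-1}\hat\pi_{t_k}(x_{t_k})\cdot\frac{\beta_{t_i,t_j}\tilde\pi_{t_j}(x_{t_j})(x_{t_j}-\mu_{\tilde\pi_{t_j}})}{\sigma^2_{\tilde\pi_{t_j}}};$$ these functions are assumed to be pmfs (regularity). The permutation property of the joint distribution means: for every pair of permutations $g,h$ of $\{1,\dots,n\}$ and all $x_{s_i}\in\mathbf{X}_{s_i}$ ($1\le i\le n$), $$\Pi_{s_{g(1)},\dots,s_{g(n)}}(x_{s_{g(1)}},\dots,x_{s_{g(n)}})=\Pi_{s_{h(1)},\dots,s_{h(n)}}(x_{s_{h(1)}},\dots,x_{s_{h(n)}}).$$ *)

theory Defs
  imports "HOL-Probability.Probability" "HOL-Combinatorics.Permutations"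
begin

definition site_space :: "'s set \<Rightarrow> ('s \<Rightarrow> 's set) \<Rightarrow> bool" where
  "site_space S nb \<longleftrightarrow> finite S \<and>
     (\<forall>s\<in>S. nb s \<subseteq> S \<and> s \<notin> nb s) \<and>
     (\<forall>s\<in>S. \<forall>t\<in>S. s \<in> nb t \<longleftrightarrow> t \<in> nb s)"

definition connected_sites :: "'s set \<Rightarrow> ('s \<Rightarrow> 's set) \<Rightarrow> bool" where
  "connected_sites S nb \<longleftrightarrow>
     (\<forall>s\<in>S. \<forall>t\<in>S. (s, t) \<in> {(u, v). u \<in> S \<and> v \<in> S \<and> v \<in> nb u}\<^sup>*)"

definition pmf_mean :: "real pmf \<Rightarrow> real" where
  "pmf_mean p = measure_pmf.expectation p (\<lambda>x. x)"

definition pmf_var :: "real pmf \<Rightarrow> real" where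
  "pmf_var p = measure_pmf.variance p (\<lambda>x. x)"

text \<open>
  Laws on the finite sets \<open>X s\<close>: \<open>\<pi>\<close> is strictly positive on \<open>X s\<close>, hence its support is
  all of \<open>X s\<close>; the auxiliary laws \<open>\<pi>t\<close> (\<open>\<pi>\<close> with a tilde) and \<open>\<pi>h\<close> (\<open>\<pi>\<close> with a hat) may
  vanish at points of \<open>X s\<close>.
\<close>

definition site_laws ::
  "'s set \<Rightarrow> ('s \<Rightarrow> real set) \<Rightarrow> ('s \<Rightarrow> real pmf) \<Rightarrow> ('s \<Rightarrow> real pmf) \<Rightarrow> ('s \<Rightarrow> real pmf) \<Rightarrow> bool" where
  "site_laws A X \<pi> \<pi>t \<pi>h \<longleftrightarrow>
     (\<forall>s\<in>A. finite (X s) \<and> set_pmf (\<pi> s) = X s \<and>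
        set_pmf (\<pi>t s) \<subseteq> X s \<and> set_pmf (\<pi>h s) \<subseteq> X s \<and> pmf_var (\<pi>t s) > 0)"

text \<open>
  \<open>joint \<pi> \<pi>t \<pi>h \<beta> t i x\<close> is the joint function of the first \<open>i\<close> sites of the ordering
  \<open>t 1, t 2, \<dots>\<close>, evaluated at the values \<open>x (t 1), \<dots>, x (t i)\<close> of the configuration \<open>x\<close>.
  The value for \<open>i = 0\<close> is a dummy that is never used.
\<close>

fun joint ::
  "('s \<Rightarrow> real pmf) \<Rightarrow> ('s \<Rightarrow> real pmf) \<Rightarrow> ('s \<Rightarrow> real pmf) \<Rightarrow> ('s \<Rightarrow> 's \<Rightarrow> real) \<Rightarrow>
    (nat \<Rightarrow> 's) \<Rightarrow> nat \<Rightarrow> ('s \<Rightarrow> real) \<Rightarrow> real" where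
  "joint \<pi> \<pi>t \<pi>h \<beta> t 0 x = 1"
| "joint \<pi> \<pi>t \<pi>h \<beta> t (Suc 0) x = pmf (\<pi> (t 1)) (x (t 1))"
| "joint \<pi> \<pi>t \<pi>h \<beta> t (Suc (Suc m)) x =
     (let i = Suc (Suc m) in
        joint \<pi> \<pi>t \<pi>h \<beta> t (Suc m) x * pmf (\<pi> (t i)) (x (t i)) +
        pmf (\<pi>t (t i)) (x (t i)) * (x (t i) - pmf_mean (\<pi>t (t i))) / pmf_var (\<pi>t (t i)) *
        (\<Sum>j\<in>{1..i - 1}.
           (\<Prod>k\<in>{1..i - 1} - {j}. pmf (\<pi>h (t k)) (x (t k))) *
           (\<beta> (t i) (t j) * pmf (\<pi>t (t j)) (x (t j)) * (x (t j) - pmf_mean (\<pi>t (t j)))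
              / pmf_var (\<pi>t (t j)))))"

definition is_pmf_on :: "'c set \<Rightarrow> ('c \<Rightarrow> real) \<Rightarrow> bool" where
  "is_pmf_on C f \<longleftrightarrow> (\<forall>x\<in>C. f x \<ge> 0) \<and> (\<Sum>x\<in>C. f x) = 1"

definition regular_field ::
  "'s set \<Rightarrow> ('s \<Rightarrow> real set) \<Rightarrow> ('s \<Rightarrow> real pmf) \<Rightarrow> ('s \<Rightarrow> real pmf) \<Rightarrow> ('s \<Rightarrow> real pmf) \<Rightarrow>
    ('s \<Rightarrow> 's \<Rightarrow> real) \<Rightarrow> bool" where
  "regular_field A X \<pi> \<pi>t \<pi>h \<beta> \<longleftrightarrow>
     (\<forall>t. bij_betw t {1..card A} A \<longrightarrow>
        (\<forall>i\<in>{1..card A}. is_pmf_on (\<Pi>\<^sub>E u\<in>t ` {1..i}. X u) (joint \<pi> \<pi>t \<pi>h \<beta> t i)))"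

definition permutation_property ::
  "nat \<Rightarrow> (nat \<Rightarrow> 's) \<Rightarrow> ('s \<Rightarrow> real set) \<Rightarrow> ('s \<Rightarrow> real pmf) \<Rightarrow> ('s \<Rightarrow> real pmf) \<Rightarrow>
    ('s \<Rightarrow> real pmf) \<Rightarrow> ('s \<Rightarrow> 's \<Rightarrow> real) \<Rightarrow> bool" where
  "permutation_property n s X \<pi> \<pi>t \<pi>h \<beta> \<longleftrightarrow>
     (\<forall>g h. g permutes {1..n} \<longrightarrow> h permutes {1..n} \<longrightarrow>
        (\<forall>x. (\<forall>i\<in>{1..n}. x (s i) \<in> X (s i)) \<longrightarrow>
           joint \<pi> \<pi>t \<pi>h \<beta> (s \<circ> g) n x = joint \<pi> \<pi>t \<pi>h \<beta> (s \<circ> h) n x))"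

end

theory Submission
  imports Defs
begin

text \<open>
  When \<open>\<pi>h = \<pi>\<close>, unrolling the recursion gives
  \<open>\<Prod>\<^sub>u p u + \<Sum>\<^sub>{\<^sub>u\<^sub>,\<^sub>v\<^sub>} \<beta> u v * q u * q v * \<Prod>\<^sub>w\<^sub>\<noteq>\<^sub>u\<^sub>,\<^sub>v p w\<close> with \<open>p u = \<pi> u (x u)\<close> and
  \<open>q u = \<pi>t u (x u) * (x u - \<mu> u) / \<sigma>\<^sup>2 u\<close>, the sum ranging over unordered pairs of sites. By
  symmetry of \<open>\<beta>\<close> this depends only on the set of sites and not on their order.
\<close>

text \<open>The factor \<open>1 / 2\<close> compensates for summing over ordered instead of unordered pairs.\<close>

definition pair_expansion ::
  "('s \<Rightarrow> real) \<Rightarrow> ('s \<Rightarrow> real) \<Rightarrow> ('s \<Rightarrow> 's \<Rightarrow> real) \<Rightarrow> 's set \<Rightarrow> real" where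
  "pair_expansion p q \<beta> B = (\<Prod>u\<in>B. p u) +
     (\<Sum>u\<in>B. \<Sum>v\<in>B - {u}. \<beta> u v * q u * q v * (\<Prod>w\<in>B - {u} - {v}. p w)) / 2"

lemma pair_expansion_singleton [simp]: "pair_expansion p q \<beta> {a} = p a"
  by (simp add: pair_expansion_def)

text \<open>Pairs inside \<open>B\<close> keep their term up to a new factor \<open>p a\<close> in
  the complementary product; pairs containing \<open>a\<close> make up the last sum. The right-hand
  side has the shape of one recursion step of \<open>joint\<close> with \<open>\<pi>h\<close>
  replaced by \<open>\<pi>\<close>.\<close>

lemma pair_expansion_insert:
  assumes fin: "finite B" and a: "a \<notin> B" and sym: "\<And>v. v \<in> B \<Longrightarrow> \<beta> v a = \<beta> a v"
  shows "pair_expansion p q \<beta> (insert a B) =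
    pair_expansion p q \<beta> B * p a + q a * (\<Sum>v\<in>B. (\<Prod>w\<in>B - {v}. p w) * (\<beta> a v * q v))"
proof -
  let ?c = "\<lambda>B u v. \<beta> u v * q u * q v * (\<Prod>w\<in>B - {u} - {v}. p w)"
  let ?L = "\<lambda>v. \<beta> a v * q a * q v * (\<Prod>w\<in>B - {v}. p w)"
  \<comment> \<open>With \<open>u\<close> in \<open>B\<close> fixed, the partner
    \<open>v = a\<close> is split off. For every other partner, \<open>a\<close> lies in the
    complement and contributes \<open>p a\<close>.\<close>
  have outer: "(\<Sum>v\<in>insert a B - {u}. ?c (insert a B) u v) = ?L u + (\<Sum>v\<in>B - {u}. ?c B u v) * p a"
    if u: "u \<in> B" for u
  proof -
    have ne: "u \<noteq> a" using u a by blast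
    have old: "?c (insert a B) u v = ?c B u v * p a" if "v \<in> B - {u}" for v
    proof -
      have "insert a B - {u} - {v} = insert a (B - {u} - {v})" using that a ne by blast
      then show ?thesis using fin a by simp
    qed
    \<comment> \<open>The term carries \<open>\<beta> u a\<close> but \<open>?L u\<close> carries
      \<open>\<beta> a u\<close>: symmetry enters here.\<close>
    have "?c (insert a B) u a = ?L u"
    proof -
      have "insert a B - {u} - {a} = B - {u}" using a by blast
      then show ?thesis using sym[OF u] by simp
    qed
    moreover have "insert a B - {u} = insert a (B - {u})" using ne by blast
    then have "(\<Sum>v\<in>insert a B - {u}. ?c (insert a B) u v) =
        ?c (insert a B) u a + (\<Sum>v\<in>B - {u}. ?c (insert a B) u v)"
      using fin a by (simp only: sum.insert finite_Diff Diff_iff simp_thms)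
    moreover have "(\<Sum>v\<in>B - {u}. ?c (insert a B) u v) = (\<Sum>v\<in>B - {u}. ?c B u v) * p a"
      unfolding sum_distrib_right by (rule sum.cong[OF refl old])
    ultimately show ?thesis by simp
  qed
  have "(\<Sum>u\<in>insert a B. \<Sum>v\<in>insert a B - {u}. ?c (insert a B) u v) =
      (\<Sum>v\<in>B. ?L v) + (\<Sum>u\<in>B. ?L u + (\<Sum>v\<in>B - {u}. ?c B u v) * p a)"
    using fin a outer by simp
  \<comment> \<open>Each pair containing \<open>a\<close> is met twice, once from \<open>a\<close>
    and once from its partner; this 2 cancels the \<open>1 / 2\<close> of
    \<open>pair_expansion\<close>.\<close>
  also have "\<dots> = 2 * (\<Sum>v\<in>B. ?L v) + (\<Sum>u\<in>B. \<Sum>v\<in>B - {u}. ?c B u v) * p a"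
    by (simp add: sum.distrib sum_distrib_right)
  finally have pairs: "(\<Sum>u\<in>insert a B. \<Sum>v\<in>insert a B - {u}. ?c (insert a B) u v) = \<dots>" .
  have "(\<Sum>v\<in>B. ?L v) = q a * (\<Sum>v\<in>B. (\<Prod>w\<in>B - {v}. p w) * (\<beta> a v * q v))"
    by (simp add: sum_distrib_left mult_ac)
  then show ?thesis
    unfolding pair_expansion_def pairs prod.insert[OF fin a] by argo
qed

text \<open>By induction on \<open>m\<close>, since \<open>pair_expansion_insert\<close> with
  \<open>a = t (Suc m)\<close> matches the recursion once sums and products over indices are turned
  into ones over sites.\<close>

lemma joint_eq_pair_expansion:
  fixes t :: "nat \<Rightarrow> 's" and m :: nat
  assumes "m \<ge> 1" and "inj_on t {1..m}"
    and "\<And>u v. u \<in> t ` {1..m} \<Longrightarrow> v \<in> t ` {1..m} \<Longrightarrow> u \<noteq> v \<Longrightarrow> \<beta> u v = \<beta> v u"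
    and "\<And>u. u \<in> t ` {1..m} \<Longrightarrow> \<pi>h u = \<pi> u"
  shows "joint \<pi> \<pi>t \<pi>h \<beta> t m x = pair_expansion (\<lambda>u. pmf (\<pi> u) (x u))
    (\<lambda>u. pmf (\<pi>t u) (x u) * (x u - pmf_mean (\<pi>t u)) / pmf_var (\<pi>t u)) \<beta> (t ` {1..m})"
    (is "_ = pair_expansion ?p ?q _ _")
  using assms
proof (induction m rule: dec_induct)
  case base
  then show ?case by simp
next
  case (step m)
  \<comment> \<open>Exposes \<open>Suc (Suc k)\<close>, the pattern of the recursive equation of
    \<open>joint\<close>.\<close>
  obtain k where m: "m = Suc k" using step.hyps(1) by (cases m) auto
  let ?B = "t ` {1..m}"
  have interval: "{1..Suc m} = insert (Suc m) {1..m}" by auto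
  have inj: "inj_on t {1..m}" and new: "t (Suc m) \<notin> ?B"
    using step.prems(1) unfolding interval by auto
  have IH: "joint \<pi> \<pi>t \<pi>h \<beta> t m x = pair_expansion ?p ?q \<beta> ?B"
    using inj step.prems(2,3) unfolding interval by (intro step.IH) auto
  have sym: "\<beta> v (t (Suc m)) = \<beta> (t (Suc m)) v" if "v \<in> ?B" for v
  proof (rule step.prems(2))
    show "v \<noteq> t (Suc m)" using that new by blast
  qed (use that interval in auto)
  have hat: "\<pi>h (t k) = \<pi> (t k)" if "k \<in> {1..m}" for k
    using that by (intro step.prems(3)) auto
  \<comment> \<open>The equality of \<open>\<pi>h\<close> and \<open>\<pi>\<close> turns the hat
    product into one of \<open>?p\<close>; by injectivity, dropping index \<open>j\<close> drops
    exactly the site \<open>t j\<close>.\<close>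
  have prods: "(\<Prod>k\<in>{1..m} - {j}. pmf (\<pi>h (t k)) (x (t k))) = (\<Prod>w\<in>?B - {t j}. ?p w)"
    if "j \<in> {1..m}" for j
  proof -
    have img: "?B - {t j} = t ` ({1..m} - {j})"
      using inj_on_image_set_diff[OF inj, of "{1..m}" "{j}"] that by auto
    have inj': "inj_on t ({1..m} - {j})"
      using inj by (rule inj_on_subset) blast
    show ?thesis
      unfolding img prod.reindex[OF inj'] by (rule prod.cong) (simp_all add: hat)
  qed
  have "joint \<pi> \<pi>t \<pi>h \<beta> t (Suc m) x = joint \<pi> \<pi>t \<pi>h \<beta> t m x * ?p (t (Suc m)) + ?q (t (Suc m)) *
      (\<Sum>j\<in>{1..m}. (\<Prod>k\<in>{1..m} - {j}. pmf (\<pi>h (t k)) (x (t k))) * (\<beta> (t (Suc m)) (t j) * ?q (t j)))"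
    by (simp add: m Let_def mult.assoc)
  also have "(\<Sum>j\<in>{1..m}. (\<Prod>k\<in>{1..m} - {j}. pmf (\<pi>h (t k)) (x (t k))) * (\<beta> (t (Suc m)) (t j) * ?q (t j)))
      = (\<Sum>j\<in>{1..m}. (\<Prod>w\<in>?B - {t j}. ?p w) * (\<beta> (t (Suc m)) (t j) * ?q (t j)))"
    by (intro sum.cong refl) (simp only: prods)
  also have "\<dots> = (\<Sum>v\<in>?B. (\<Prod>w\<in>?B - {v}. ?p w) * (\<beta> (t (Suc m)) v * ?q v))"
    by (simp only: sum.reindex[OF inj] o_def)
  also have "joint \<pi> \<pi>t \<pi>h \<beta> t m x * ?p (t (Suc m)) + ?q (t (Suc m)) * \<dots> =
      pair_expansion ?p ?q \<beta> (insert (t (Suc m)) ?B)"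
    unfolding IH using new sym by (intro pair_expansion_insert[symmetric]) auto
  finally show ?case by (simp only: interval image_insert)
qed

theorem corollary5p2:
  fixes S A :: "'s set" and nb :: "'s \<Rightarrow> 's set"
    and n :: nat and s :: "nat \<Rightarrow> 's"
    and X :: "'s \<Rightarrow> real set"
    and \<pi> \<pi>t \<pi>h :: "'s \<Rightarrow> real pmf"
    and \<beta> :: "'s \<Rightarrow> 's \<Rightarrow> real"
  assumes "site_space S nb" and "connected_sites S nb"
    and "n \<ge> 3"
    and "inj_on s {1..n}" and "A = s ` {1..n}" and "A \<subseteq> S"
    and "\<forall>u\<in>A. \<forall>v\<in>A. u \<noteq> v \<longrightarrow> v \<in> nb u"
    and "site_laws A X \<pi> \<pi>t \<pi>h"
    and "\<forall>u\<in>A. \<forall>v\<in>A. u \<noteq> v \<longrightarrow> \<beta> u v = \<beta> v u"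
    and "regular_field A X \<pi> \<pi>t \<pi>h \<beta>"
    and "\<forall>i\<in>{1..n}. \<pi>h (s i) = \<pi> (s i)"
  shows "permutation_property n s X \<pi> \<pi>t \<pi>h \<beta>"
proof -
  \<comment> \<open>The right-hand side does not mention \<open>g\<close>, so any two orderings
    agree.\<close>
  have "joint \<pi> \<pi>t \<pi>h \<beta> (s \<circ> g) n x = pair_expansion (\<lambda>u. pmf (\<pi> u) (x u))
      (\<lambda>u. pmf (\<pi>t u) (x u) * (x u - pmf_mean (\<pi>t u)) / pmf_var (\<pi>t u)) \<beta> A"
    if g: "g permutes {1..n}" for g x
  proof -
    have img: "(s \<circ> g) ` {1..n} = A"
      using permutes_image[OF g] assms(5) by (simp only: image_comp[symmetric])
    have "inj_on (s \<circ> g) {1..n}"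
      using permutes_inj_on[OF g] permutes_image[OF g] assms(4) by (intro comp_inj_on) simp_all
    then have "joint \<pi> \<pi>t \<pi>h \<beta> (s \<circ> g) n x = pair_expansion (\<lambda>u. pmf (\<pi> u) (x u))
        (\<lambda>u. pmf (\<pi>t u) (x u) * (x u - pmf_mean (\<pi>t u)) / pmf_var (\<pi>t u)) \<beta> ((s \<circ> g) ` {1..n})"
    \<comment> \<open>Rotation puts the injectivity premise first, to meet the chained fact, and
      leaves \<open>n \<ge> 1\<close> for the end.\<close>
    proof (rule joint_eq_pair_expansion[rotated])
      show "\<beta> u v = \<beta> v u"
        if "u \<in> (s \<circ> g) ` {1..n}" "v \<in> (s \<circ> g) ` {1..n}" "u \<noteq> v" for u v
        using that assms(9) unfolding img by blast
      show "\<pi>h u = \<pi> u" if "u \<in> (s \<circ> g) ` {1..n}" for u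
        using that assms(5,11) unfolding img by blast
    qed (use assms(3) in simp)
    then show ?thesis by (simp only: img)
  qed
  then show ?thesis by (simp add: permutation_property_def)
qed

end
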